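(* If $\mathcal{A}$ is an adequate family of finite subsets of $\mathbb{N}$ which is spreading, then $h_{\mathcal{A},1}^*$ fails to have any delta-points.
   Context: All Banach spaces are real. $B_X$, $S_X$, $X^*$ denote the closed unit ball, unit sphere and topological dual of a Banach space $X$. Adequate family: a family $\mathcal{A}$ of subsets of $\mathbb{N}=\{1,2,\dots\}$ is adequate if (1) it contains the empty set and all singletons $\{i\}$, $i\in\mathbb{N}$; (2) it is hereditary: $A\in\mathcal{A}$ and $B\subseteq A$ imply $B\in\mathcal{A}$; (3) it is compact for pointwise convergence, i.e. given $A\subset\mathbb{N}$, if every finite subset of $A$ is in $\mathcal{A}$, then $A\in\mathcal{A}$. An adequate family of finite subsets is one all of whose members are finite. Spreading: an adequate family $\mathcal{A}$ of finite sets is spreading if whenever $\{k_1,\dots,k_n\}\in\mathcal{A}$ and $k_i\le l_i$ for $i=1,\dots,n$, then $\{l_1,\dots,l_n\}\in\mathcal{A}$ (elements of the sets listed in increasing order). The space $h_{\mathcal{A},1}$: the completion of the space $c_{00}$ of finitely supported sequences, with standard basis $(e_i)_{i\in\mathbb{N}}$, in the norm $\left\|\sum_{i=1}^n a_i e_i\right\| = \sup_{A\in\mathcal{A}}\sum_{i\in A}|a_i|$ (with $a_i=0$ for $i>n$). Slices: for $f\in S_{X^*}$ and $\delta>0$, $S(f,\delta)=\{x\in B_X : f(x)>1-\delta\}$. Delta-point: $x\in S_X$ is a delta-point of $X$ if for every slice $S(f,\delta)$ of $B_X$ with $x\in S(f,\delta)$ and every $\varepsilon>0$ there exists $y\in S(f,\delta)$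 with $\|x-y\|\ge 2-\varepsilon$. (Here this is applied with $X=h_{\mathcal{A},1}^*$, so the slices are given by functionals in $S_{h_{\mathcal{A},1}^{**}}$.) *)

theory Defs
  imports "HOL-Analysis.Analysis"
begin

section \<open>Adequate and spreading families\<close>

text \<open>
  The index set is \<open>{1, 2, \<dots>}\<close>, that is, \<open>{1..}\<close> as a set of type \<^typ>\<open>nat set\<close>.
\<close>

definition adequate :: "nat set set \<Rightarrow> bool" where
  "adequate \<A> \<longleftrightarrow>
     \<A> \<subseteq> Pow {1..} \<and>
     {} \<in> \<A> \<and> (\<forall>i\<ge>1. {i} \<in> \<A>) \<and>
     (\<forall>A\<in>\<A>. \<forall>B\<subseteq>A. B \<in> \<A>) \<and>
     (\<forall>A\<subseteq>{1..}. (\<forall>F\<subseteq>A. finite F \<longrightarrow> F \<in> \<A>) \<longrightarrow> A \<in> \<A>)"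

definition spreading :: "nat set set \<Rightarrow> bool" where
  "spreading \<A> \<longleftrightarrow>
     (\<forall>ks ls. sorted_wrt (<) ks \<longrightarrow> sorted_wrt (<) ls \<longrightarrow> list_all2 (\<le>) ks ls \<longrightarrow>
        set ks \<in> \<A> \<longrightarrow> set ls \<in> \<A>)"

section \<open>The space \<open>h\<^sub>\<A>\<^sub>,\<^sub>1\<close>\<close>

text \<open>
  Sequences indexed by \<open>{1, 2, \<dots>}\<close> are functions on \<^typ>\<open>nat\<close> vanishing at \<open>0\<close>.
\<close>

definition c00 :: "(nat \<Rightarrow> real) set" where
  "c00 = {a. a 0 = 0 \<and> finite {i. a i \<noteq> 0}}"

text \<open>
  The sum over \<open>A\<close> is restricted to the support of \<open>a\<close>, which is finite for \<open>a\<close> in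
  \<^const>\<open>c00\<close>, so that the formula is also right for infinite \<open>A\<close>.
\<close>

definition h1_norm :: "nat set set \<Rightarrow> (nat \<Rightarrow> real) \<Rightarrow> real" where
  "h1_norm \<A> a = (SUP A\<in>\<A>. \<Sum>i\<in>A \<inter> {i. a i \<noteq> 0}. \<bar>a i\<bar>)"

text \<open>
  A type cannot depend on the family \<open>\<A>\<close>. The completion of \<^const>\<open>c00\<close> is therefore given, as
  usual up to isometric isomorphism, by a Banach space \<open>'a\<close> together with a linear isometric
  embedding \<open>J\<close> of \<open>(c00, h1_norm \<A>)\<close> with dense range. Values of \<open>J\<close> outside
  \<^const>\<open>c00\<close> are irrelevant.
\<close>

definition is_h1_space :: "nat set set \<Rightarrow> ((nat \<Rightarrow> real) \<Rightarrow> 'a::banach) \<Rightarrow> bool" where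
  "is_h1_space \<A> J \<longleftrightarrow>
     (\<forall>a\<in>c00. \<forall>b\<in>c00. J (\<lambda>i. a i + b i) = J a + J b) \<and>
     (\<forall>r. \<forall>a\<in>c00. J (\<lambda>i. r * a i) = r *\<^sub>R J a) \<and>
     (\<forall>a\<in>c00. norm (J a) = h1_norm \<A> a) \<and>
     closure (J ` c00) = UNIV"

section \<open>Slices and delta-points\<close>

definition slice :: "('b::banach \<Rightarrow>\<^sub>L real) \<Rightarrow> real \<Rightarrow> 'b set" where
  "slice f \<delta> = {x \<in> cball 0 1. blinfun_apply f x > 1 - \<delta>}"

definition delta_point :: "'b::banach \<Rightarrow> bool" where
  "delta_point x \<longleftrightarrow>
     x \<in> sphere 0 1 \<and>
     (\<forall>f \<delta>. norm f = 1 \<longrightarrow> \<delta> > 0 \<longrightarrow> x \<in> slice f \<delta> \<longrightarrow>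
        (\<forall>\<epsilon>>0. \<exists>y\<in>slice f \<delta>. norm (x - y) \<ge> 2 - \<epsilon>))"

end

theory Submission
  imports Defs
begin

text \<open>
  Compactness of the family forces tails of a functional \<open>f\<close> on \<open>h\<^sub>\<A>\<^sub>,\<^sub>1\<close> to be small in norm (the basis
  is shrinking): by induction along end extensions, any block sequence of positive normalised vectors
  has convex combinations of arbitrarily small norm. Hence only finitely many coordinates of a norm one
  functional \<open>f\<close> have modulus 1, and the moduli of the others are at most some \<open>\<beta> < 1\<close>. A slice given
  by a vector of \<open>h\<^sub>\<A>\<^sub>,\<^sub>1\<close> forces \<open>y\<close> to imitate \<open>f\<close> on these coordinates and on the first
  coordinate \<open>i\<close> of the support of \<open>f\<close>. Suppose that \<open>f\<close> is almost 1 and \<open>y\<close> almost \<open>-1\<close> at a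
  vector \<open>z\<close> of the unit ball. Then the mass of \<open>z\<close> nearly exhausts a set \<open>B - {i}\<close> with
  \<open>i \<in> B \<in> \<A>\<close>; since \<open>\<A>\<close> is spreading, \<open>i\<close> can be exchanged for any later index, so \<open>z\<close> is
  small off \<open>B\<close>; and on \<open>B\<close> the signs of \<open>z\<close> prevent \<open>f\<close> from picking up more than about
  \<open>\<beta>\<close>. So \<open>f\<close> is not almost 1 at \<open>z\<close>, and every \<open>y\<close> in the slice has distance
  from \<open>f\<close> bounded away from 2.
\<close>

section \<open>The norm on finitely supported sequences\<close>

text \<open>The value at \<open>z\<close> of the functional whose coordinate sequence is
  \<open>F\<close>. Summing over the support of \<open>z\<close> gives a finite sum on
  \<open>c00\<close> for arbitrary \<open>F\<close>.\<close>

definition pairing :: "(nat \<Rightarrow> real) \<Rightarrow> (nat \<Rightarrow> real) \<Rightarrow> real" where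
  "pairing F z = (\<Sum>n | z n \<noteq> 0. F n * z n)"

lemma pairing_eq_sum:
  assumes "finite S" "{n. z n \<noteq> 0} \<subseteq> S"
  shows "pairing F z = (\<Sum>n\<in>S. F n * z n)"
  unfolding pairing_def using assms by (intro sum.mono_neutral_left) auto

lemma pairing_diff:
  assumes "a \<in> c00" "b \<in> c00"
  shows "pairing F (\<lambda>n. a n - r * b n) = pairing F a - r * pairing F b"
proof -
  let ?S = "{n. a n \<noteq> 0} \<union> {n. b n \<noteq> 0}"
  have S: "finite ?S" using assms by (simp add: c00_def)
  have "pairing F (\<lambda>n. a n - r * b n) = (\<Sum>n\<in>?S. F n * (a n - r * b n))"
    by (rule pairing_eq_sum[OF S]) auto
  also have "\<dots> = (\<Sum>n\<in>?S. F n * a n) - r * (\<Sum>n\<in>?S. F n * b n)"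
    by (simp add: sum_subtractf sum_distrib_left algebra_simps)
  also have "\<dots> = pairing F a - r * pairing F b"
    using pairing_eq_sum[OF S, of a F] pairing_eq_sum[OF S, of b F] by auto
  finally show ?thesis .
qed

lemma c00_dominated:
  assumes "b \<in> c00" "\<And>n. b n = 0 \<Longrightarrow> a n = 0"
  shows "a \<in> c00"
  using assms unfolding c00_def by (auto intro: finite_subset[of "{n. a n \<noteq> 0}" "{n. b n \<noteq> 0}"])

locale finite_adequate =
  fixes \<A> :: "nat set set"
  assumes adq: "adequate \<A>" and fin: "\<forall>A\<in>\<A>. finite A"
begin

lemma empty_mem: "{} \<in> \<A>"
  and hereditary: "A \<in> \<A> \<Longrightarrow> B \<subseteq> A \<Longrightarrow> B \<in> \<A>"
  using adq unfolding adequate_def by auto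

lemma sum_le_h1_norm:
  assumes "z \<in> c00" "A \<in> \<A>"
  shows "(\<Sum>n\<in>A. \<bar>z n\<bar>) \<le> h1_norm \<A> z"
proof -
  have "bdd_above ((\<lambda>A. \<Sum>i\<in>A \<inter> {i. z i \<noteq> 0}. \<bar>z i\<bar>) ` \<A>)"
    by (rule bdd_aboveI2[where M="\<Sum>i | z i \<noteq> 0. \<bar>z i\<bar>"], rule sum_mono2)
      (use assms(1) in \<open>auto simp: c00_def\<close>)
  then have "(\<Sum>i\<in>A \<inter> {i. z i \<noteq> 0}. \<bar>z i\<bar>) \<le> h1_norm \<A> z"
    unfolding h1_norm_def by (rule cSUP_upper[OF assms(2)])
  moreover have "(\<Sum>n\<in>A. \<bar>z n\<bar>) = (\<Sum>i\<in>A \<inter> {i. z i \<noteq> 0}. \<bar>z i\<bar>)"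
    using fin assms(2) by (intro sum.mono_neutral_right) auto
  ultimately show ?thesis by simp
qed

lemma h1_norm_le:
  assumes "\<And>A. A \<in> \<A> \<Longrightarrow> (\<Sum>n\<in>A. \<bar>z n\<bar>) \<le> c"
  shows "h1_norm \<A> z \<le> c"
  unfolding h1_norm_def
proof (rule cSUP_least)
  show "\<A> \<noteq> {}" using empty_mem by auto
  fix A assume A: "A \<in> \<A>"
  have "(\<Sum>i\<in>A \<inter> {i. z i \<noteq> 0}. \<bar>z i\<bar>) \<le> (\<Sum>n\<in>A. \<bar>z n\<bar>)"
    using fin A by (intro sum_mono2) auto
  with assms[OF A] show "(\<Sum>i\<in>A \<inter> {i. z i \<noteq> 0}. \<bar>z i\<bar>) \<le> c" by simp
qed

lemma h1_norm_mono:
  assumes "b \<in> c00" "\<And>n. \<bar>a n\<bar> \<le> \<bar>b n\<bar>"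
  shows "h1_norm \<A> a \<le> h1_norm \<A> b"
  using assms(2) by (intro h1_norm_le order_trans[OF sum_mono sum_le_h1_norm[OF assms(1)]])


section \<open>Small convex combinations of blocks\<close>

text \<open>Decreasing convex sets of positive normalised vectors whose supports escape to infinity;
  they play the role of the convex hulls of the tails of a block sequence.\<close>

definition blocks :: "(nat \<Rightarrow> (nat \<Rightarrow> real) set) \<Rightarrow> bool" where
  "blocks W \<longleftrightarrow> (\<forall>N. W N \<noteq> {} \<and> W (Suc N) \<subseteq> W N \<and>
     (\<forall>w\<in>W N. (\<forall>n. 0 \<le> w n) \<and> (\<forall>n\<le>N. w n = 0) \<and> finite {n. w n \<noteq> 0} \<and>
        (\<forall>A\<in>\<A>. sum w A \<le> 1)) \<and>
     (\<forall>u\<in>W N. \<forall>v\<in>W N. \<forall>t. 0 \<le> t \<and> t \<le> 1 \<longrightarrow> (\<lambda>n. t * u n + (1 - t) * v n) \<in> W N))"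

lemma blocksD:
  assumes "blocks W"
  shows "\<exists>w. w \<in> W N" and "W (Suc N) \<subseteq> W N"
    and "w \<in> W N \<Longrightarrow> 0 \<le> w n" and "w \<in> W N \<Longrightarrow> n \<le> N \<Longrightarrow> w n = 0"
    and "w \<in> W N \<Longrightarrow> finite {n. w n \<noteq> 0}" and "w \<in> W N \<Longrightarrow> A \<in> \<A> \<Longrightarrow> sum w A \<le> 1"
    and "u \<in> W N \<Longrightarrow> v \<in> W N \<Longrightarrow> 0 \<le> t \<Longrightarrow> t \<le> 1 \<Longrightarrow> (\<lambda>n. t * u n + (1 - t) * v n) \<in> W N"
  using assms unfolding blocks_def by (simp_all add: ex_in_conv)

text \<open>The sets \<open>s \<union> E\<close> are the end extensions of \<open>s\<close> within
  the family. For empty \<open>s\<close> the order condition is vacuous, so \<open>w\<close> has sum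
  at most \<open>\<epsilon>\<close> on every member.\<close>

definition small_beyond :: "real \<Rightarrow> nat set \<Rightarrow> (nat \<Rightarrow> real) \<Rightarrow> bool" where
  "small_beyond \<epsilon> s w \<longleftrightarrow> (\<forall>E. s \<union> E \<in> \<A> \<and> (\<forall>x\<in>s. \<forall>e\<in>E. x < e) \<longrightarrow> sum w E \<le> \<epsilon>)"

text \<open>The property passed down the tree of end extensions. Quantifying over all
  \<open>W\<close> allows it to be applied to blocks already thinned out for other sets.\<close>

definition reducible :: "nat set \<Rightarrow> bool" where
  "reducible s \<longleftrightarrow> (\<forall>W \<epsilon> N. blocks W \<and> 0 < \<epsilon> \<longrightarrow> (\<exists>w\<in>W N. small_beyond \<epsilon> s w))"

lemma blocks_antimono:
  assumes "blocks W" "M \<le> N" shows "W N \<subseteq> W M"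
  using lift_Suc_antimono_le[of W, OF blocksD(2)[OF assms(1)] assms(2)] .

text \<open>Smallness beyond \<open>s\<close> is a convex condition, and reducibility provides a
  witness at every level, so the filtered sets are blocks again.\<close>

lemma blocks_small_beyond:
  assumes W: "blocks W" and s: "reducible s" and e: "0 < \<epsilon>"
  shows "blocks (\<lambda>N. {w \<in> W N. small_beyond \<epsilon> s w})"
proof -
  have conv: "small_beyond \<epsilon> s (\<lambda>n. t * u n + (1 - t) * v n)"
    if "small_beyond \<epsilon> s u" "small_beyond \<epsilon> s v" "0 \<le> t" "t \<le> 1" for u v t
    unfolding small_beyond_def
  proof (intro allI impI)
    fix E assume E: "s \<union> E \<in> \<A> \<and> (\<forall>x\<in>s. \<forall>e\<in>E. x < e)"
    have "sum u E \<le> \<epsilon>" "sum v E \<le> \<epsilon>" using that E unfolding small_beyond_def by auto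
    then have "t * sum u E + (1 - t) * sum v E \<le> t * \<epsilon> + (1 - t) * \<epsilon>"
      using that by (intro add_mono mult_left_mono) auto
    also have "t * \<epsilon> + (1 - t) * \<epsilon> = \<epsilon>" by (simp add: algebra_simps)
    finally show "(\<Sum>n\<in>E. t * u n + (1 - t) * v n) \<le> \<epsilon>"
      by (simp add: sum.distrib sum_distrib_left)
  qed
  have ne: "\<exists>w. w \<in> W N \<and> small_beyond \<epsilon> s w" for N
    using s W e unfolding reducible_def by blast
  show ?thesis
    unfolding blocks_def
  proof (intro allI conjI ballI impI)
    show "{w \<in> W N. small_beyond \<epsilon> s w} \<noteq> {}" for N using ne[of N] by blast
    show "{w \<in> W (Suc N). small_beyond \<epsilon> s w} \<subseteq> {w \<in> W N. small_beyond \<epsilon> s w}" for N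
      using blocksD(2)[OF W, of N] by blast
  qed (auto intro: blocksD(3-7)[OF W] conv)
qed

text \<open>Filter the blocks by one set, then apply the induction hypothesis to the filtered
  blocks; hence \<open>W\<close> is generalised.\<close>

lemma small_beyond_finite:
  assumes "finite T" "\<And>s. s \<in> T \<Longrightarrow> reducible s" "blocks W" "0 < \<epsilon>"
  shows "\<exists>w\<in>W N. \<forall>s\<in>T. small_beyond \<epsilon> s w"
  using assms
proof (induction T arbitrary: W rule: finite_induct)
  case empty
  then show ?case using blocksD(1) by auto
next
  case (insert s T)
  have "blocks (\<lambda>N. {w \<in> W N. small_beyond \<epsilon> s w})"
    using insert.prems by (intro blocks_small_beyond) auto
  from insert.IH[OF _ this] insert.prems show ?case by auto
qed

text \<open>Convexity is available for two vectors only, so the equal-weight average is built by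
  adding one vector at a time with weight \<open>1 - ?t\<close>.\<close>

lemma blocks_average:
  assumes W: "blocks W" and w: "\<And>r. w r \<in> W N"
  shows "(\<lambda>n. (\<Sum>r<Suc R. w r n) / real (Suc R)) \<in> W N"
proof (induction R)
  case 0
  then show ?case using w[of 0] by simp
next
  case (Suc R)
  let ?t = "real (Suc R) / real (Suc (Suc R))"
  have t: "0 \<le> ?t" "?t \<le> 1" by (auto simp: field_simps)
  have "(\<lambda>n. ?t * ((\<Sum>r<Suc R. w r n) / real (Suc R)) + (1 - ?t) * w (Suc R) n) \<in> W N"
    by (rule blocksD(7)[OF W Suc w t])
  moreover have "?t * ((\<Sum>r<Suc R. w r n) / real (Suc R)) + (1 - ?t) * w (Suc R) n
      = (\<Sum>r<Suc (Suc R). w r n) / real (Suc (Suc R))" for n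
  proof -
    have "1 - ?t = 1 / real (Suc (Suc R))" by (simp add: field_simps)
    moreover have "?t * (S / real (Suc R)) = S / real (Suc (Suc R))" for S
      by simp
    ultimately show ?thesis
      by (simp only: sum.lessThan_Suc[of _ "Suc R"] add_divide_distrib) simp
  qed
  ultimately show ?case by simp
qed

text \<open>Each new block is chosen small on all extensions of \<open>s\<close> whose next element lies in the range
  of the previous blocks, so a given extension of \<open>s\<close> sees at most one block that is not small,
  and averaging many blocks makes that one negligible.\<close>

lemma reducible_step:
  assumes IH: "\<And>n. insert n s \<in> \<A> \<Longrightarrow> \<forall>x\<in>s. x < n \<Longrightarrow> reducible (insert n s)"
  shows "reducible s"
  unfolding reducible_def
proof (intro allI impI)
  fix W :: "nat \<Rightarrow> (nat \<Rightarrow> real) set" and \<epsilon> :: real and N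
  assume "blocks W \<and> 0 < \<epsilon>"
  then have W: "blocks W" and e: "0 < \<epsilon>" by auto
  \<comment> \<open>The recursion carries a block \<open>w\<close> with a bound \<open>M\<close> on
    its support. The next block lives beyond \<open>M\<close> and is small beyond
    \<open>insert n s\<close> for each of the finitely many admissible
    \<open>n \<le> M\<close>.\<close>
  define P where "P = (\<lambda>(w, M). w \<in> W N \<and> N \<le> M \<and> (\<forall>n>M. w n = 0))"
  define Q where "Q = (\<lambda>(w::nat \<Rightarrow> real, M) (w', M'). w' \<in> W M \<and> M \<le> M' \<and>
     (\<forall>n\<le>M. insert n s \<in> \<A> \<and> (\<forall>x\<in>s. x < n) \<longrightarrow> small_beyond (\<epsilon>/2) (insert n s) w'))"
  have bound: "\<exists>M'\<ge>M. \<forall>n>M'. w n = 0" if "w \<in> W K" for w K and M :: nat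
  proof -
    have "finite {n. w n \<noteq> 0}" by (rule blocksD(5)[OF W that])
    then obtain b where "\<forall>n\<in>{n. w n \<noteq> 0}. n \<le> b" using finite_nat_set_iff_bounded_le by blast
    then show ?thesis by (intro exI[of _ "max M b"]) (auto simp: not_le)
  qed
  have "\<exists>h. \<forall>r. P (h r) \<and> Q (h r) (h (Suc r))"
  proof (rule dependent_nat_choice)
    obtain w where w: "w \<in> W N" using blocksD(1)[OF W] by blast
    with bound[OF w] show "\<exists>x. P x" unfolding P_def by auto
  next
    fix x r assume x: "P x"
    obtain w M where wM: "x = (w, M)" by force
    let ?T = "{insert n s | n. n \<le> M \<and> insert n s \<in> \<A> \<and> (\<forall>x\<in>s. x < n)}"
    have "?T \<subseteq> (\<lambda>n. insert n s) ` {..M}" by auto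
    then have "finite ?T" using finite_subset by blast
    then have "\<exists>w'\<in>W M. \<forall>t\<in>?T. small_beyond (\<epsilon>/2) t w'"
      using IH W e by (intro small_beyond_finite) auto
    then obtain w' where w': "w' \<in> W M" "\<forall>t\<in>?T. small_beyond (\<epsilon>/2) t w'" by blast
    obtain M' where M': "M' \<ge> M" "\<forall>n>M'. w' n = 0" using bound[OF w'(1)] by blast
    have "N \<le> M" using x wM unfolding P_def by auto
    then have "P (w', M')" using w'(1) M' blocks_antimono[OF W] unfolding P_def by auto
    moreover have "Q x (w', M')" using w' M' unfolding Q_def wM by auto
    ultimately show "\<exists>y. P y \<and> Q x y" by blast
  qed
  then obtain h where h: "\<And>r. P (h r)" "\<And>r. Q (h r) (h (Suc r))" by blast
  define w where "w r = fst (h r)" for r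
  define M where "M r = snd (h r)" for r
  have wW: "w r \<in> W N" and wM: "n > M r \<Longrightarrow> w r n = 0" for r n
    using h(1)[of r] unfolding P_def w_def M_def by (auto split: prod.splits)
  have step: "w (Suc r) \<in> W (M r)" "M r \<le> M (Suc r)"
    "n \<le> M r \<Longrightarrow> insert n s \<in> \<A> \<Longrightarrow> \<forall>x\<in>s. x < n \<Longrightarrow>
       small_beyond (\<epsilon>/2) (insert n s) (w (Suc r))" for r n
    using h(2)[of r] unfolding Q_def w_def M_def by (auto split: prod.splits)
  have M_mono: "M p \<le> M q" if "p \<le> q" for p q
    using that step(2) lift_Suc_mono_le by blast
  \<comment> \<open>This makes the weight \<open>1 / real (Suc R)\<close> of the single exceptional
    block less than \<open>\<epsilon>/2\<close>.\<close>
  obtain R where R: "2 / \<epsilon> < real R" using reals_Archimedean2 by blast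
  define v where "v = (\<lambda>n. (\<Sum>r<Suc R. w r n) / real (Suc R))"
  have "v \<in> W N" unfolding v_def by (rule blocks_average[OF W wW])
  moreover have "small_beyond \<epsilon> s v"
    unfolding small_beyond_def
  proof (intro allI impI)
    fix E assume E: "s \<union> E \<in> \<A> \<and> (\<forall>x\<in>s. \<forall>e\<in>E. x < e)"
    then have EA: "E \<in> \<A>" and finE: "finite E" using hereditary fin by blast+
    show "sum v E \<le> \<epsilon>"
    proof (cases "E = {}")
      case False
      define n where "n = Min E"
      have nE: "n \<in> E" and n_less: "\<And>e. e \<in> E - {n} \<Longrightarrow> n < e"
        using False finE unfolding n_def by (auto simp: less_le)
      have ins: "insert n s \<in> \<A>" using E nE hereditary[of "s \<union> E" "insert n s"] by auto
      \<comment> \<open>The first block whose bound reaches \<open>n = Min E\<close>. Earlier blocks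
        vanish on \<open>E\<close>, later ones are small there, and block \<open>p\<close> itself
        contributes at most 1. If no bound reaches \<open>n\<close>, all blocks vanish on
        \<open>E\<close>.\<close>
      define p where "p = (LEAST r. n \<le> M r)"
      have each: "sum (w q) E \<le> \<epsilon>/2 + (if q = p then 1 else 0)" for q
      proof (cases "n \<le> M q")
        case False
        then have "w q e = 0" if "e \<in> E" for e
          using that n_less[of e] wM[where r=q and n=e] by (cases "e = n") auto
        then show ?thesis using e by simp
      next
        case True
        then have pq: "p \<le> q" unfolding p_def by (rule Least_le)
        have p: "n \<le> M p" unfolding p_def using True by (rule LeastI)
        show ?thesis
        proof (cases "q = p")
          case True
          have "sum (w q) E \<le> 1" by (rule blocksD(6)[OF W wW EA])
          then show ?thesis using True e by simp
        next
          case False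
          with pq obtain r where r: "q = Suc r" "p \<le> r" by (cases q) auto
          have nr: "n \<le> M r" using p M_mono[OF r(2)] by simp
          \<comment> \<open>Block \<open>q\<close> starts after \<open>n\<close>, so
            \<open>E\<close> may be replaced by \<open>E - {n}\<close>, which end-extends
            \<open>insert n s\<close>.\<close>
          have "w q n = 0" unfolding r(1) by (rule blocksD(4)[OF W step(1) nr])
          then have "sum (w q) E = sum (w q) (E - {n})"
            using finE nE by (simp add: sum.remove)
          moreover have "insert n s \<union> (E - {n}) = s \<union> E" using nE by auto
          moreover have "small_beyond (\<epsilon>/2) (insert n s) (w q)"
            unfolding r(1) using step(3) nr ins E nE by blast
          ultimately have "sum (w q) E \<le> \<epsilon>/2"
            using E n_less unfolding small_beyond_def
            by (metis (no_types, lifting) Diff_iff insert_iff)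
          then show ?thesis using False by simp
        qed
      qed
      have "sum v E = (\<Sum>q<Suc R. sum (w q) E) / real (Suc R)"
        unfolding v_def sum_divide_distrib[symmetric] by (subst sum.swap) simp
      also have "\<dots> \<le> (\<Sum>q<Suc R. \<epsilon>/2 + (if q = p then 1 else 0)) / real (Suc R)"
        by (intro divide_right_mono sum_mono each) auto
      also have "\<dots> \<le> (real (Suc R) * (\<epsilon>/2) + 1) / real (Suc R)"
        unfolding sum.distrib by (intro divide_right_mono add_mono) auto
      also have "\<dots> \<le> \<epsilon>"
        using R e by (simp add: field_simps)
      finally show ?thesis .
    qed (use e in simp)
  qed
  ultimately show "\<exists>w\<in>W N. small_beyond \<epsilon> s w" by blast
qed

text \<open>A bad chain of end extensions would have an infinite union, which compactness puts
  into the family.\<close>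

lemma reducible_empty: "reducible {}"
proof (rule ccontr)
  assume nr: "\<not> reducible {}"
  define P where "P s \<longleftrightarrow> s \<in> \<A> \<and> \<not> reducible s" for s
  define Q where "Q s t \<longleftrightarrow> (\<exists>n. t = insert n s \<and> (\<forall>x\<in>s. x < n))" for s t :: "nat set"
  have "\<exists>h. \<forall>r::nat. P (h r) \<and> Q (h r) (h (Suc r))"
  proof (rule dependent_nat_choice)
    show "\<exists>x. P x" using nr empty_mem unfolding P_def by blast
    show "\<exists>t. P t \<and> Q s t" if "P s" for s and r :: nat
      using that reducible_step[of s] unfolding P_def Q_def by blast

  qed
  then obtain h where h: "\<And>r. P (h r)" "\<And>r. Q (h r) (h (Suc r))" by blast
  have mono: "h p \<subseteq> h q" if "p \<le> q" for p q
  proof -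
    have "h r \<subseteq> h (Suc r)" for r using h(2)[of r] unfolding Q_def by blast
    then show ?thesis by (rule lift_Suc_mono_le[OF _ that])
  qed
  have hA: "h r \<in> \<A>" for r using h(1) unfolding P_def by blast
  \<comment> \<open>Unbounded cardinalities rule out a finite union.\<close>
  have card: "r \<le> card (h r)" for r
  proof (induction r)
    case (Suc r)
    obtain n where "h (Suc r) = insert n (h r)" "n \<notin> h r"
      using h(2)[of r] unfolding Q_def by blast
    with Suc fin hA[of r] show ?case by simp
  qed simp
  have "(\<Union>r. h r) \<in> \<A>"
  proof -
    have "F \<in> \<A>" if F: "F \<subseteq> (\<Union>r. h r)" "finite F" for F
    proof -
      have "\<exists>r. F \<subseteq> h r" using F(2,1)
      proof (induction F rule: finite_induct)
        case (insert x F)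
        then obtain p q where "F \<subseteq> h p" "x \<in> h q" by auto
        then show ?case using mono[of p "max p q"] mono[of q "max p q"]
          by (intro exI[of _ "max p q"]) auto
      qed simp
      then show ?thesis using hereditary hA by blast
    qed
    moreover have "(\<Union>r. h r) \<subseteq> {1..}" using adq hA unfolding adequate_def by blast
    ultimately show ?thesis using adq unfolding adequate_def by blast
  qed
  then have f: "finite (\<Union>r. h r)" using fin by blast
  have "card (h (Suc (card (\<Union>r. h r)))) \<le> card (\<Union>r. h r)"
    by (rule card_mono[OF f]) auto
  with card[of "Suc (card (\<Union>r. h r))"] show False by simp
qed


section \<open>Functionals on the space\<close>

text \<open>The coordinate sequences of functionals of norm at most 1. A one-sided bound suffices
  because \<open>c00\<close> is symmetric.\<close>

definition contractive :: "(nat \<Rightarrow> real) \<Rightarrow> bool" where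
  "contractive F \<longleftrightarrow> F 0 = 0 \<and> (\<forall>z\<in>c00. pairing F z \<le> h1_norm \<A> z)"

text \<open>Otherwise vectors arbitrarily far out pair with \<open>F\<close> above
  \<open>\<eta>\<close>. Their moduli pair with the modulus of \<open>F\<close> at least as well,
  and so do convex combinations; one of small norm contradicts contractivity.\<close>

lemma contractive_shrinking:
  assumes F: "contractive F" and \<eta>: "0 < \<eta>"
  obtains N where "\<And>z. z \<in> c00 \<Longrightarrow> h1_norm \<A> z \<le> 1 \<Longrightarrow> \<forall>n\<le>N. z n = 0 \<Longrightarrow> pairing F z \<le> \<eta>"
proof (rule ccontr)
  assume "\<not> thesis"
  then have ex: "\<exists>z\<in>c00. h1_norm \<A> z \<le> 1 \<and> (\<forall>n\<le>N. z n = 0) \<and> pairing F z > \<eta>" for N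
    using that by (meson not_le)
  define W where "W N = {w \<in> c00. (\<forall>n. 0 \<le> w n) \<and> (\<forall>n\<le>N. w n = 0) \<and> (\<forall>A\<in>\<A>. sum w A \<le> 1)
      \<and> \<eta> \<le> pairing (\<lambda>n. \<bar>F n\<bar>) w}" for N
  have "blocks W"
    unfolding blocks_def
  proof (intro allI conjI ballI impI)
    fix N
    obtain z where z: "z \<in> c00" "h1_norm \<A> z \<le> 1" "\<forall>n\<le>N. z n = 0" "pairing F z > \<eta>"
      using ex by blast
    have "pairing F z \<le> pairing (\<lambda>n. \<bar>F n\<bar>) (\<lambda>n. \<bar>z n\<bar>)"
      unfolding pairing_def by (auto simp flip: abs_mult intro!: sum_mono)
    then have "(\<lambda>n. \<bar>z n\<bar>) \<in> W N"
      using z sum_le_h1_norm[OF z(1)] unfolding W_def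
      by (auto simp: c00_def intro: order_trans)
    then show "W N \<noteq> {}" by blast
    show "W (Suc N) \<subseteq> W N" unfolding W_def by auto
  next
    fix N u v and t :: real
    assume u: "u \<in> W N" and v: "v \<in> W N" and t: "0 \<le> t \<and> t \<le> 1"
    let ?S = "{n. u n \<noteq> 0} \<union> {n. v n \<noteq> 0}"
    have S: "finite ?S" using u v unfolding W_def c00_def by auto
    let ?w = "\<lambda>n. t * u n + (1 - t) * v n"
    have "{n. ?w n \<noteq> 0} \<subseteq> ?S" by auto
    then have "?w \<in> c00" using finite_subset[OF _ S] u v unfolding W_def c00_def by auto
    moreover have "\<eta> \<le> pairing (\<lambda>n. \<bar>F n\<bar>) ?w"
    proof -
      have "\<eta> = t * \<eta> + (1 - t) * \<eta>" by (simp add: algebra_simps)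
      also have "\<dots> \<le> t * pairing (\<lambda>n. \<bar>F n\<bar>) u + (1 - t) * pairing (\<lambda>n. \<bar>F n\<bar>) v"
        using u v t unfolding W_def by (intro add_mono mult_left_mono) auto
      also have "\<dots> = pairing (\<lambda>n. \<bar>F n\<bar>) ?w"
      proof -
        have "pairing (\<lambda>n. \<bar>F n\<bar>) ?w = (\<Sum>n\<in>?S. \<bar>F n\<bar> * ?w n)"
          by (rule pairing_eq_sum[OF S]) auto
        also have "\<dots> = t * (\<Sum>n\<in>?S. \<bar>F n\<bar> * u n) + (1 - t) * (\<Sum>n\<in>?S. \<bar>F n\<bar> * v n)"
          unfolding sum_distrib_left sum.distrib[symmetric]
          by (rule sum.cong) (auto simp: algebra_simps)
        also have "(\<Sum>n\<in>?S. \<bar>F n\<bar> * u n) = pairing (\<lambda>n. \<bar>F n\<bar>) u"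
          by (rule pairing_eq_sum[OF S, symmetric]) auto
        also have "(\<Sum>n\<in>?S. \<bar>F n\<bar> * v n) = pairing (\<lambda>n. \<bar>F n\<bar>) v"
          by (rule pairing_eq_sum[OF S, symmetric]) auto
        finally show ?thesis by simp
      qed
      finally show ?thesis .
    qed
    moreover have "sum ?w A \<le> 1" if "A \<in> \<A>" for A
    proof -
      have "t * sum u A + (1 - t) * sum v A \<le> t * 1 + (1 - t) * 1"
        using u v t that unfolding W_def by (intro add_mono mult_left_mono) auto
      then show ?thesis by (simp add: sum.distrib sum_distrib_left)
    qed
    ultimately show "?w \<in> W N" using u v t unfolding W_def by auto
  qed (auto simp: W_def c00_def)
  then obtain w where w: "w \<in> W 0" "small_beyond (\<eta>/2) {} w"
    using reducible_empty \<eta> half_gt_zero unfolding reducible_def by blast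
  \<comment> \<open>Restoring the signs of \<open>F\<close> keeps the pairing at least
    \<open>\<eta>\<close>, while the norm is at most \<open>\<eta>/2\<close>.\<close>
  define z where "z n = sgn (F n) * w n" for n
  have z: "z \<in> c00" using w(1) unfolding W_def z_def by (auto intro: c00_dominated[of w])
  have "\<eta> \<le> pairing (\<lambda>n. \<bar>F n\<bar>) w" using w unfolding W_def by auto
  also have "\<dots> = pairing F z"
  proof -
    have "pairing F z = (\<Sum>n | w n \<noteq> 0. F n * z n)"
      using w(1) by (intro pairing_eq_sum) (auto simp: W_def c00_def z_def)
    also have "\<dots> = pairing (\<lambda>n. \<bar>F n\<bar>) w"
      unfolding pairing_def by (rule sum.cong) (simp_all add: z_def abs_sgn)
    finally show ?thesis by simp
  qed
  also have "\<dots> \<le> h1_norm \<A> z" using F z unfolding contractive_def by blast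
  also have "\<dots> \<le> \<eta>/2"
  proof (rule h1_norm_le)
    fix A assume "A \<in> \<A>"
    then have "sum w A \<le> \<eta>/2" using w unfolding small_beyond_def by auto
    moreover have "\<bar>z n\<bar> \<le> w n" for n
      using w(1) unfolding W_def z_def by (auto simp: abs_mult abs_sgn_eq)
    ultimately show "(\<Sum>n\<in>A. \<bar>z n\<bar>) \<le> \<eta>/2"
      using sum_mono[of A "\<lambda>n. \<bar>z n\<bar>" w] by simp
  qed
  finally show False using \<eta> by simp
qed

text \<open>Tests \<open>F\<close> on a signed basis vector, of norm at most 1. The bound is a
  hypothesis so that it can come from contractivity (\<open>c = 1\<close>) or from the tail
  estimate.\<close>

lemma coordinate_bound:
  assumes F: "contractive F"
    and bound: "\<And>z. z \<in> c00 \<Longrightarrow> h1_norm \<A> z \<le> 1 \<Longrightarrow> \<forall>k. k \<noteq> n \<longrightarrow> z k = 0 \<Longrightarrow> pairing F z \<le> c"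
  shows "\<bar>F n\<bar> \<le> c"
proof -
  define z where "z k = (if k = n then sgn (F n) else 0)" for k
  have z: "z \<in> c00" using F unfolding z_def c00_def contractive_def by auto
  have "pairing F z = (\<Sum>k\<in>{n}. F k * z k)"
    by (rule pairing_eq_sum) (auto simp: z_def split: if_splits)
  then have "\<bar>F n\<bar> = pairing F z" by (simp add: z_def abs_sgn)
  also have "\<dots> \<le> c"
  proof (rule bound[OF z])
    show "h1_norm \<A> z \<le> 1"
    proof (rule h1_norm_le)
      fix A assume "A \<in> \<A>"
      then have fA: "finite A" using fin by blast
      have "(\<Sum>k\<in>A. \<bar>z k\<bar>) \<le> (\<Sum>k\<in>A. if k = n then 1 else 0)"
        by (rule sum_mono) (auto simp: z_def abs_sgn_eq)
      also have "\<dots> \<le> 1" using fA by simp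
      finally show "(\<Sum>k\<in>A. \<bar>z k\<bar>) \<le> 1" .
    qed
  qed (simp add: z_def)
  finally show ?thesis .
qed

lemma contractive_coordinate_le:
  assumes "contractive F"
  shows "\<bar>F n\<bar> \<le> 1"
  using coordinate_bound[OF assms] assms unfolding contractive_def by (meson order_trans)

lemma contractive_coordinates_finite:
  assumes F: "contractive F" and e: "0 < \<epsilon>"
  shows "finite {n. \<epsilon> < \<bar>F n\<bar>}"
proof -
  obtain N where N: "\<And>z. z \<in> c00 \<Longrightarrow> h1_norm \<A> z \<le> 1 \<Longrightarrow> \<forall>n\<le>N. z n = 0 \<Longrightarrow> pairing F z \<le> \<epsilon>"
    using contractive_shrinking[OF F e] by blast
  have "\<bar>F n\<bar> \<le> \<epsilon>" if "N < n" for n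
    by (rule coordinate_bound[OF F], rule N) (use that in auto)
  then have "{n. \<epsilon> < \<bar>F n\<bar>} \<subseteq> {..N}" by (metis (mono_tags, lifting) atMost_iff mem_Collect_eq not_le subsetI)
  then show ?thesis by (rule finite_subset) simp
qed

text \<open>Only finitely many moduli exceed 1/2, so those different from 1 have, together with 1/2,
  a maximum below 1.\<close>

lemma contractive_gap:
  assumes F: "contractive F"
  obtains \<beta> where "0 \<le> \<beta>" "\<beta> < 1" "\<And>n. \<bar>F n\<bar> \<noteq> 1 \<Longrightarrow> \<bar>F n\<bar> \<le> \<beta>"
proof -
  define S where "S = {n. 1/2 < \<bar>F n\<bar> \<and> \<bar>F n\<bar> \<noteq> 1}"
  have S: "finite S"
    using contractive_coordinates_finite[OF F, of "1/2"] unfolding S_def by (auto intro: finite_subset[rotated])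
  let ?T = "insert (1/2) ((\<lambda>n. \<bar>F n\<bar>) ` S)"
  show thesis
  proof (rule that[of "Max ?T"])
    have fT: "finite ?T" using S by simp
    show "0 \<le> Max ?T" using Max_ge[OF fT, of "1/2"] by simp
    have "\<bar>F n\<bar> < 1" if "n \<in> S" for n
      using contractive_coordinate_le[OF F, of n] that unfolding S_def by auto
    then show "Max ?T < 1" using fT by (subst Max_less_iff) auto
    show "\<bar>F n\<bar> \<le> Max ?T" if "\<bar>F n\<bar> \<noteq> 1" for n
    proof (cases "n \<in> S")
      case True
      then show ?thesis using fT by (intro Max_ge) auto
    next
      case False
      then have "\<bar>F n\<bar> \<le> 1/2" using that unfolding S_def by auto
      also have "\<dots> \<le> Max ?T" using fT by (intro Max_ge) auto
      finally show ?thesis .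
    qed
  qed
qed

end

section \<open>Moving an element to the right\<close>

lemma sorted_wrt_shift:
  "sorted_wrt (<) (i # ys @ [n]) \<Longrightarrow> list_all2 (\<le>) (i # ys) (ys @ [n::nat])"
  by (induction ys arbitrary: i) auto

text \<open>In the increasing enumeration, \<open>i\<close> and the elements of \<open>B\<close>
  between \<open>i\<close> and \<open>n\<close> each move up to the next one, the last to
  \<open>n\<close>; all other entries stay. The new enumeration dominates the old one
  termwise.\<close>

lemma spreading_exchange:
  assumes sp: "spreading \<A>" and B: "B \<in> \<A>" "finite B" and i: "i \<in> B" "i < n" and n: "n \<notin> B"
  shows "insert n (B - {i}) \<in> \<A>"
proof -
  define xs where "xs = sorted_list_of_set {b\<in>B. b < i}"
  define ys where "ys = sorted_list_of_set {b\<in>B. i < b \<and> b < n}"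
  define zs where "zs = sorted_list_of_set {b\<in>B. n < b}"
  have set: "set xs = {b\<in>B. b < i}" "set ys = {b\<in>B. i < b \<and> b < n}" "set zs = {b\<in>B. n < b}"
    and sorted: "sorted_wrt (<) xs" "sorted_wrt (<) ys" "sorted_wrt (<) zs"
    using B(2) unfolding xs_def ys_def zs_def by auto
  then have mem: "\<forall>x\<in>set xs. x < i" "\<forall>x\<in>set ys. i < x" "\<forall>x\<in>set ys. x < n" "\<forall>x\<in>set zs. n < x"
    by auto
  have cross: "\<forall>x\<in>set xs. \<forall>y\<in>set ys. x < y" "\<forall>x\<in>set ys. \<forall>y\<in>set zs. x < y"
    "\<forall>x\<in>set xs. \<forall>y\<in>set zs. x < y" "\<forall>x\<in>set xs. x < n" "\<forall>x\<in>set zs. i < x"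
    using mem i by (meson less_trans)+
  have "x \<in> B \<longleftrightarrow> x \<in> set xs \<or> x = i \<or> x \<in> set ys \<or> x \<in> set zs" for x
    using i n linorder_less_linear[of x i] linorder_less_linear[of x n] unfolding set by blast
  then have ks: "set (xs @ (i # ys) @ zs) = B" by auto
  moreover have "i \<notin> set (xs @ ys @ zs)" using i unfolding set_append set by auto
  ultimately have ls: "set (xs @ (ys @ [n]) @ zs) = insert n (B - {i})" by auto
  have "sorted_wrt (<) (xs @ (i # ys) @ zs)" "sorted_wrt (<) (xs @ (ys @ [n]) @ zs)"
    using sorted mem cross i by (simp_all add: sorted_wrt_append ball_Un)
  moreover have "list_all2 (\<le>) (xs @ (i # ys) @ zs) (xs @ (ys @ [n]) @ zs)"
    using sorted mem cross i by (intro list_all2_appendI sorted_wrt_shift)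
      (auto simp: sorted_wrt_append list_all2_same)
  ultimately have "set (xs @ (ys @ [n]) @ zs) \<in> \<A>"
    using sp B(1) unfolding spreading_def ks[symmetric] by blast
  then show ?thesis unfolding ls .
qed

section \<open>A slice of the dual ball without near-antipodes of \<open>F\<close>\<close>

text \<open>The vector \<open>g\<close> has entries \<open>\<plusminus>1\<close>. A signed member of the family that nearly norms
  \<open>g - \<kappa> z\<close> must agree with \<open>F\<close> exactly on the support of \<open>g\<close>, because its value at \<open>g\<close> is an
  integer, while a large \<open>\<kappa>\<close> makes it nearly norm \<open>-z\<close>.\<close>

lemma (in finite_adequate) separating_slice:
  assumes sp: "spreading \<A>" and F: "contractive F" and F0: "\<exists>i. F i \<noteq> 0"
  obtains g s \<epsilon> where "g \<in> c00" "0 \<le> s" "s < pairing F g" "0 < \<epsilon>"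
    "\<And>y z. contractive y \<Longrightarrow> s < pairing y g \<Longrightarrow> z \<in> c00 \<Longrightarrow> h1_norm \<A> z \<le> 1 \<Longrightarrow>
       1 - \<epsilon> < pairing F z \<Longrightarrow> \<epsilon> - 1 \<le> pairing y z"
proof -
  define i where "i = (LEAST i. F i \<noteq> 0)"
  have Fi: "F i \<noteq> 0" unfolding i_def using F0 by (rule LeastI_ex)
  have before_i: "F n = 0" if "n < i" for n using not_less_Least[of n "\<lambda>i. F i \<noteq> 0"] that unfolding i_def by blast
  have F_zero: "F 0 = 0" using F by (simp add: contractive_def)
  have F1: "\<bar>F n\<bar> \<le> 1" for n by (rule contractive_coordinate_le[OF F])
  obtain \<beta> where \<beta>: "0 \<le> \<beta>" "\<beta> < 1" "\<And>n. \<bar>F n\<bar> \<noteq> 1 \<Longrightarrow> \<bar>F n\<bar> \<le> \<beta>"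
    using contractive_gap[OF F] by blast
  define c where "c = \<bar>F i\<bar>"
  have c: "0 < c" "c \<le> 1" using Fi F1[of i] unfolding c_def by auto
  \<comment> \<open>The gap \<open>1 - \<beta>\<close> is \<open>4 * \<eta>\<close>: the tail and
    the coordinates up to \<open>N\<close> off \<open>B\<close> cost \<open>\<eta>\<close> each, and
    the rest absorbs \<open>\<zeta>\<close> and \<open>\<epsilon>\<close>.\<close>
  define \<eta> where "\<eta> = (1 - \<beta>) / 4"
  have \<eta>: "0 < \<eta>" using \<beta> unfolding \<eta>_def by simp
  obtain N where N: "\<And>z. z \<in> c00 \<Longrightarrow> h1_norm \<A> z \<le> 1 \<Longrightarrow> \<forall>n\<le>N. z n = 0 \<Longrightarrow> pairing F z \<le> \<eta>"
    using contractive_shrinking[OF F \<eta>] by blast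
  \<comment> \<open>Bound for a single coordinate of \<open>z\<close> off \<open>B\<close>; up to
    \<open>N\<close> of them add up to at most \<open>\<eta>\<close>.\<close>
  define \<zeta>' where "\<zeta>' = \<eta> / real (Suc N)"
  have \<zeta>': "0 < \<zeta>'" "real N * \<zeta>' \<le> \<eta>" "\<zeta>' \<le> \<eta>"
    using \<eta> unfolding \<zeta>'_def by (auto simp: field_simps)
  define \<zeta> where "\<zeta> = c * \<zeta>' / 2"
  have \<zeta>: "0 < \<zeta>" "2 * \<zeta> / c = \<zeta>'" using c \<zeta>' unfolding \<zeta>_def by auto
  have \<zeta>_le: "2 * \<zeta> \<le> \<eta>"
    using mult_right_mono[OF c(2) less_imp_le[OF \<zeta>'(1)]] \<zeta>'(3) unfolding \<zeta>_def by simp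
  \<comment> \<open>An error of 1 in the \<open>g\<close> part becomes \<open>\<zeta>/2\<close>
    after division by \<open>\<kappa>\<close>, and \<open>\<kappa> * \<epsilon> = c/2\<close> is the
    slack built into \<open>s\<close>.\<close>
  define \<kappa> where "\<kappa> = 2 / \<zeta>"
  define \<epsilon> where "\<epsilon> = c * \<zeta> / 4"
  have \<kappa>: "0 < \<kappa>" and \<epsilon>: "0 < \<epsilon>" and \<kappa>\<epsilon>: "\<kappa> * \<epsilon> = c / 2" and \<kappa>\<zeta>: "\<kappa> * \<zeta> = 2"
    using c \<zeta> unfolding \<kappa>_def \<epsilon>_def by auto
  have \<epsilon>_le: "\<epsilon> \<le> \<zeta> / 4" using mult_right_mono[OF c(2) less_imp_le[OF \<zeta>(1)]] unfolding \<epsilon>_def by simp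
  define \<alpha> where "\<alpha> = insert i {a. \<bar>F a\<bar> = 1}"
  have fin\<alpha>: "finite \<alpha>"
    using contractive_coordinates_finite[OF F, of "1/2"] unfolding \<alpha>_def
    by (auto intro: finite_subset[rotated])
  have \<alpha>_nz: "F a \<noteq> 0" if "a \<in> \<alpha>" for a using that Fi unfolding \<alpha>_def by auto
  define g where "g n = (if n \<in> \<alpha> then sgn (F n) else 0)" for n
  have g: "g \<in> c00"
    using fin\<alpha> F_zero unfolding g_def c00_def by (auto intro: finite_subset[of _ \<alpha>])
  \<comment> \<open>\<open>g\<close> pairs with \<open>F\<close> to
    \<open>card \<alpha> - 1 + c\<close>, so \<open>s\<close> lies \<open>c/2\<close> below that
    value and \<open>c/2\<close> above \<open>card \<alpha> - 1\<close>.\<close>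
  define s where "s = real (card \<alpha>) - 1 + c / 2"
  have pg: "pairing F g = (\<Sum>n\<in>\<alpha>. \<bar>F n\<bar>)"
    by (subst pairing_eq_sum[OF fin\<alpha>]) (auto simp: g_def abs_sgn intro!: sum.cong)
  also have "\<dots> = c + (\<Sum>n\<in>\<alpha> - {i}. \<bar>F n\<bar>)"
    unfolding c_def using fin\<alpha> by (intro sum.remove) (auto simp: \<alpha>_def)
  also have "(\<Sum>n\<in>\<alpha> - {i}. \<bar>F n\<bar>) = real (card (\<alpha> - {i}))"
    by (subst sum.cong[where h="\<lambda>_. 1" and B="\<alpha> - {i}"]) (auto simp: \<alpha>_def)
  also have "real (card (\<alpha> - {i})) = real (card \<alpha>) - 1"
    using fin\<alpha> card_Suc_Diff1[of \<alpha> i] by (simp add: \<alpha>_def of_nat_diff flip: of_nat_Suc)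
  finally have "s < pairing F g" using c unfolding s_def by simp
  have "1 \<le> card \<alpha>" using fin\<alpha> by (simp add: \<alpha>_def Suc_le_eq card_gt_0_iff)
  then have s0: "0 \<le> s" using c unfolding s_def by simp
  show thesis
  proof (rule that[OF g s0 \<open>s < pairing F g\<close> \<epsilon>], rule ccontr)
    fix y z
    assume y: "contractive y" "s < pairing y g" and z: "z \<in> c00" "h1_norm \<A> z \<le> 1"
      and Fz: "1 - \<epsilon> < pairing F z" and "\<not> \<epsilon> - 1 \<le> pairing y z"
    then have yz: "pairing y z < \<epsilon> - 1" by simp
    have z_sum: "(\<Sum>n\<in>A. \<bar>z n\<bar>) \<le> 1" if "A \<in> \<A>" for A
      using sum_le_h1_norm[OF z(1) that] z(2) by simp
    define x where "x n = g n - \<kappa> * z n" for n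
    have x: "x \<in> c00"
    proof -
      have "{n. x n \<noteq> 0} \<subseteq> {n. g n \<noteq> 0} \<union> {n. z n \<noteq> 0}" unfolding x_def by auto
      then show ?thesis using g z(1) finite_subset unfolding c00_def x_def by auto
    qed
    have "\<kappa> * pairing y z \<le> \<kappa> * (\<epsilon> - 1)" using yz \<kappa> by (intro mult_left_mono) auto
    then have "s + \<kappa> * (1 - \<epsilon>) < pairing y x"
      using y(2) pairing_diff[OF g z(1), of y \<kappa>] unfolding x_def by (simp add: algebra_simps)
    also have "\<dots> \<le> h1_norm \<A> x" using y(1) x unfolding contractive_def by blast
    finally have "\<not> h1_norm \<A> x \<le> s + \<kappa> * (1 - \<epsilon>)" by simp
    then obtain B where B: "B \<in> \<A>" and Bx: "s + \<kappa> * (1 - \<epsilon>) < (\<Sum>n\<in>B. \<bar>x n\<bar>)"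
      using h1_norm_le[of x] not_le by blast
    have finB: "finite B" using B fin by blast
    \<comment> \<open>The signs with which \<open>B\<close> norms \<open>x\<close>; the value at
      zero is 1, so that \<open>\<theta>\<close> never vanishes. The sum over \<open>B\<close> then
      splits into a \<open>g\<close> part and \<open>\<kappa>\<close> times the sum of
      \<open>u\<close>.\<close>
    define \<theta> where "\<theta> n = (if x n \<ge> 0 then 1 else - 1 :: real)" for n
    have \<theta>_abs: "\<bar>\<theta> n * r\<bar> = \<bar>r\<bar>" for n r unfolding \<theta>_def by auto
    define u where "u n = - \<theta> n * z n" for n
    have u_abs: "\<bar>u n\<bar> = \<bar>z n\<bar>" for n using \<theta>_abs[of n "- z n"] unfolding u_def by simp
    have "(\<Sum>n\<in>B. \<bar>x n\<bar>) = (\<Sum>n\<in>B. \<theta> n * g n) + \<kappa> * (\<Sum>n\<in>B. u n)"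
      unfolding sum_distrib_left sum.distrib[symmetric]
      by (rule sum.cong) (auto simp: \<theta>_def u_def x_def)
    then have split: "s + \<kappa> * (1 - \<epsilon>) < (\<Sum>n\<in>B. \<theta> n * g n) + \<kappa> * (\<Sum>n\<in>B. u n)" using Bx by simp
    have u_le: "(\<Sum>n\<in>B. \<bar>u n\<bar>) \<le> 1" using z_sum[OF B] by (simp add: u_abs)
    have "(\<Sum>n\<in>B. u n) \<le> (\<Sum>n\<in>B. \<bar>u n\<bar>)" by (rule sum_mono) simp
    with u_le have "\<kappa> * (\<Sum>n\<in>B. u n) \<le> \<kappa>" using \<kappa> by simp
    with split have \<theta>g: "real (card \<alpha>) - 1 < (\<Sum>n\<in>B. \<theta> n * g n)"
      using \<kappa>\<epsilon> unfolding s_def by (simp add: algebra_simps)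
    define t where "t n = (if n \<in> B then \<theta> n * sgn (F n) else 0)" for n
    have \<theta>g_eq: "(\<Sum>n\<in>B. \<theta> n * g n) = (\<Sum>n\<in>\<alpha>. t n)"
      using finB fin\<alpha> by (intro sum.mono_neutral_cong) (auto simp: g_def t_def)
    have t_le: "t n \<le> 1" for n unfolding t_def \<theta>_def by (auto simp: sgn_if)
    \<comment> \<open>All terms \<open>t n\<close> are at most 1 and their sum exceeds
      \<open>card \<alpha> - 1\<close>. A disagreement would give a term at most 0.\<close>
    have agree: "a \<in> B \<and> \<theta> a = sgn (F a)" if a: "a \<in> \<alpha>" for a
    proof (rule ccontr)
      assume "\<not> (a \<in> B \<and> \<theta> a = sgn (F a))"
      then have "t a \<le> 0" using \<alpha>_nz[OF a] unfolding t_def \<theta>_def by (auto simp: sgn_if split: if_splits)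
      moreover have "(\<Sum>n\<in>\<alpha> - {a}. t n) \<le> real (card (\<alpha> - {a})) * 1"
        using t_le by (intro sum_bounded_above) auto
      moreover have "real (card (\<alpha> - {a})) = real (card \<alpha>) - 1"
        using fin\<alpha> a card_Suc_Diff1[of \<alpha> a] by (simp add: of_nat_diff flip: of_nat_Suc)
      ultimately show False
        using \<theta>g sum.remove[OF fin\<alpha> a, of t] unfolding \<theta>g_eq by simp
    qed
    have "(\<Sum>n\<in>B. \<theta> n * g n) \<le> real (card \<alpha>)"
      using sum_bounded_above[of \<alpha> t 1] t_le unfolding \<theta>g_eq by simp
    with split have "\<kappa> * (1 - \<epsilon>) - 1 < \<kappa> * (\<Sum>n\<in>B. u n)" using c unfolding s_def by simp
    moreover have "1 = \<kappa> * (\<zeta> / 2)" using \<kappa>\<zeta> by simp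
    ultimately have "\<kappa> * (1 - \<epsilon> - \<zeta> / 2) < \<kappa> * (\<Sum>n\<in>B. u n)" by (simp add: algebra_simps)
    then have "1 - \<epsilon> - \<zeta> / 2 < (\<Sum>n\<in>B. u n)" using \<kappa> by simp
    then have u_gt: "1 - \<zeta> < (\<Sum>n\<in>B. u n)" using \<epsilon>_le \<zeta> by simp
    have iB: "i \<in> B" and \<theta>i: "\<theta> i = sgn (F i)" using agree[of i] unfolding \<alpha>_def by auto

    \<comment> \<open>As \<open>\<theta>\<close> agrees with \<open>F\<close> at \<open>i\<close>,
      coordinate \<open>i\<close> contributes \<open>- c * u i\<close> to
      \<open>pairing F z\<close>. The other coordinates give at most 1, and the total exceeds
      \<open>1 - \<epsilon>\<close>.\<close>
    have ui: "u i \<le> \<zeta> / c"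
    proof (cases "u i \<le> 0")
      case True
      then show ?thesis using \<zeta> c by (meson divide_nonneg_pos less_imp_le order_trans)
    next
      case False
      define z1 where "z1 n = (if n = i then 0 else z n)" for n
      have z1: "z1 \<in> c00" by (rule c00_dominated[OF z(1)]) (simp add: z1_def)
      have S: "finite (insert i {n. z n \<noteq> 0})" using z(1) by (simp add: c00_def)
      have "pairing F z = (\<Sum>n\<in>insert i {n. z n \<noteq> 0}. F n * z n)"
        by (rule pairing_eq_sum[OF S]) auto
      also have "\<dots> = F i * z i + (\<Sum>n\<in>insert i {n. z n \<noteq> 0} - {i}. F n * z n)"
        using S by (rule sum.remove) simp
      also have "(\<Sum>n\<in>insert i {n. z n \<noteq> 0} - {i}. F n * z n) = pairing F z1"
        by (subst pairing_eq_sum[of "insert i {n. z n \<noteq> 0} - {i}" z1])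
          (use S in \<open>auto simp: z1_def intro!: sum.cong split: if_splits\<close>)
      also have "pairing F z1 \<le> 1"
      proof -
        have "pairing F z1 \<le> h1_norm \<A> z1" using F z1 unfolding contractive_def by blast
        also have "\<dots> \<le> h1_norm \<A> z" by (rule h1_norm_mono[OF z(1)]) (simp add: z1_def)
        finally show ?thesis using z(2) by simp
      qed
      also have "F i * z i = - c * u i"
        unfolding u_def \<theta>i c_def using Fi by (simp add: sgn_if abs_if)
      finally have "c * u i \<le> \<zeta>" using Fz \<epsilon>_le \<zeta> by simp
      then show ?thesis using c by (simp add: field_simps)
    qed
    \<comment> \<open>After exchanging \<open>i\<close> for \<open>n\<close>, the modulus of
      \<open>z n\<close> fits into what \<open>B - {i}\<close> leaves of the unit mass, at most
      \<open>\<zeta> + \<zeta> / c\<close>.\<close>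
    have off_B: "\<bar>z n\<bar> \<le> \<zeta>'" if n: "n \<notin> B" "i < n" for n
    proof -
      have "insert n (B - {i}) \<in> \<A>" by (rule spreading_exchange[OF sp B finB iB n(2,1)])
      then have "(\<Sum>n\<in>insert n (B - {i}). \<bar>z n\<bar>) \<le> 1" by (rule z_sum)
      then have "\<bar>z n\<bar> + (\<Sum>n\<in>B - {i}. \<bar>u n\<bar>) \<le> 1" using finB n by (simp add: u_abs)
      moreover have "(\<Sum>n\<in>B - {i}. u n) \<le> (\<Sum>n\<in>B - {i}. \<bar>u n\<bar>)" by (rule sum_mono) simp
      moreover have "(\<Sum>n\<in>B. u n) = u i + (\<Sum>n\<in>B - {i}. u n)" using finB iB by (rule sum.remove)
      moreover have "\<zeta> \<le> \<zeta> / c" using c \<zeta> by (simp add: field_simps)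
      moreover have "\<zeta>' = \<zeta> / c + \<zeta> / c" using \<zeta>(2) by simp
      ultimately show ?thesis using u_gt ui by linarith
    qed

    \<comment> \<open>On \<open>\<alpha>\<close> only negative \<open>u n\<close> help
      \<open>F\<close>, and they are controlled by the sum of \<open>\<bar>u n\<bar> - u n\<close>,
      at most \<open>\<zeta>\<close>. Elsewhere on \<open>B\<close> the coordinates of
      \<open>F\<close> are at most \<open>\<beta>\<close> in modulus.\<close>
    have on_B: "(\<Sum>n\<in>B. F n * z n) \<le> \<zeta> + \<beta>"
    proof -
      have "F n * z n \<le> (\<bar>u n\<bar> - u n) + \<beta> * \<bar>u n\<bar>" if "n \<in> B" for n
      proof (cases "n \<in> \<alpha>")
        case True
        then have "F n * z n = - \<bar>F n\<bar> * u n"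
          using agree[OF True] \<alpha>_nz[OF True] unfolding u_def by (simp add: sgn_if abs_if)
        also have "\<dots> \<le> \<bar>u n\<bar> - u n"
        proof (cases "0 \<le> u n")
          case True
          then show ?thesis by simp
        next
          case False
          then have "\<bar>F n\<bar> * (- u n) \<le> 1 * (- u n)" using F1[of n] by (intro mult_right_mono) auto
          then show ?thesis using False by simp
        qed
        also have "\<dots> \<le> (\<bar>u n\<bar> - u n) + \<beta> * \<bar>u n\<bar>" using \<beta> by simp
        finally show ?thesis .
      next
        case False
        then have "\<bar>F n\<bar> \<le> \<beta>" using \<beta>(3) unfolding \<alpha>_def by auto
        then have "\<bar>F n * z n\<bar> \<le> \<beta> * \<bar>u n\<bar>" unfolding abs_mult u_abs by (intro mult_right_mono) auto
        then show ?thesis using abs_ge_self[of "F n * z n"] abs_ge_self[of "u n"] by linarith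
      qed
      then have "(\<Sum>n\<in>B. F n * z n) \<le> (\<Sum>n\<in>B. (\<bar>u n\<bar> - u n) + \<beta> * \<bar>u n\<bar>)" by (rule sum_mono)
      also have "\<dots> = (\<Sum>n\<in>B. \<bar>u n\<bar>) - (\<Sum>n\<in>B. u n) + \<beta> * (\<Sum>n\<in>B. \<bar>u n\<bar>)"
        by (simp add: sum.distrib sum_subtractf sum_distrib_left)
      also have "\<dots> \<le> 1 - (1 - \<zeta>) + \<beta> * 1"
        using u_le u_gt \<beta> by (intro add_mono diff_mono mult_left_mono) auto
      finally show ?thesis by simp
    qed

    have "pairing F z \<le> (\<zeta> + \<beta>) + \<eta> + \<eta>"
    proof -
      \<comment> \<open>Three pieces: \<open>B\<close>, the indices up to \<open>N\<close> off
        \<open>B\<close>, and the tail \<open>z2\<close>, which is handled by shrinking. In the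
        middle piece \<open>F\<close> vanishes before \<open>i\<close>, and \<open>off_B\<close>
        applies after \<open>i\<close>.\<close>
      define z2 where "z2 n = (if n \<in> B \<or> n \<le> N then 0 else z n)" for n
      have z2: "z2 \<in> c00" by (rule c00_dominated[OF z(1)]) (simp add: z2_def)
      let ?L = "{1..N} - B"
      let ?S = "B \<union> {..N} \<union> {n. z n \<noteq> 0}"
      have S: "finite ?S" using z(1) finB by (simp add: c00_def)
      have "pairing F z = (\<Sum>n\<in>?S. F n * z n)"
        by (rule pairing_eq_sum[OF S]) auto
      also have "\<dots> = (\<Sum>n\<in>?S. (if n \<in> B then F n * z n else 0) +
          (if n \<in> ?L then F n * z n else 0) + F n * z2 n)"
        by (rule sum.cong) (auto simp: z2_def F_zero not_le Suc_le_eq)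
      also have "\<dots> = (\<Sum>n\<in>B. F n * z n) + (\<Sum>n\<in>?L. F n * z n) + pairing F z2"
      proof -
        have "pairing F z2 = (\<Sum>n\<in>?S. F n * z2 n)"
          by (rule pairing_eq_sum[OF S]) (auto simp: z2_def)
        moreover have "?S \<inter> B = B" "?S \<inter> ?L = ?L" by auto
        ultimately show ?thesis
          by (simp only: sum.distrib sum.inter_restrict[OF S, symmetric])
      qed
      also have "(\<Sum>n\<in>?L. F n * z n) \<le> \<eta>"
      proof -
        have "F n * z n \<le> \<zeta>'" if "n \<in> ?L" for n
        proof (cases "n < i")
          case True
          then show ?thesis using before_i \<zeta>' by simp
        next
          case False
          with that iB have "i < n" by (cases "n = i") auto
          then have "\<bar>F n * z n\<bar> \<le> 1 * \<zeta>'"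
            unfolding abs_mult using off_B[of n] that F1[of n] by (intro mult_mono) auto
          then show ?thesis by (simp add: abs_le_iff)
        qed
        then have "(\<Sum>n\<in>?L. F n * z n) \<le> real (card ?L) * \<zeta>'" by (rule sum_bounded_above)
        also have "\<dots> \<le> real N * \<zeta>'"
          using card_mono[of "{1..N}" ?L] \<zeta>' by (intro mult_right_mono) auto
        finally show ?thesis using \<zeta>' by simp
      qed
      also have "pairing F z2 \<le> \<eta>"
      proof (rule N[OF z2])
        have "h1_norm \<A> z2 \<le> h1_norm \<A> z" by (rule h1_norm_mono[OF z(1)]) (simp add: z2_def)
        then show "h1_norm \<A> z2 \<le> 1" using z(2) by simp
      qed (simp add: z2_def)
      finally show ?thesis using on_B by simp
    qed
    then show False
      using Fz \<epsilon>_le \<zeta> \<zeta>_le \<eta> unfolding \<eta>_def by (simp add: field_simps)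
  qed
qed

section \<open>Transfer to the dual space\<close>

theorem proposition4p9:
  fixes \<A> :: "nat set set" and J :: "(nat \<Rightarrow> real) \<Rightarrow> 'a::banach"
  assumes "adequate \<A>"
    and "\<forall>A\<in>\<A>. finite A"
    and "spreading \<A>"
    and "is_h1_space \<A> J"
  shows "\<not> (\<exists>x :: 'a \<Rightarrow>\<^sub>L real. delta_point x)"
proof
  interpret finite_adequate \<A> using assms by unfold_locales
  assume "\<exists>x :: 'a \<Rightarrow>\<^sub>L real. delta_point x"
  then obtain f :: "'a \<Rightarrow>\<^sub>L real" where delta: "delta_point f" by blast
  then have nf: "norm f = 1" unfolding delta_point_def by simp
  have J_add: "\<And>a b. a \<in> c00 \<Longrightarrow> b \<in> c00 \<Longrightarrow> J (\<lambda>i. a i + b i) = J a + J b"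
    and J_scale: "\<And>a r. a \<in> c00 \<Longrightarrow> J (\<lambda>i. r * a i) = r *\<^sub>R J a"
    and J_norm: "\<And>a. a \<in> c00 \<Longrightarrow> norm (J a) = h1_norm \<A> a"
    and J_dense: "closure (J ` c00) = UNIV"
    using assms(4) unfolding is_h1_space_def by blast+
  define e where "e k = (\<lambda>n. if n = k then 1 else 0 :: real)" for k :: nat
  \<comment> \<open>The value at 0 is set to 0, since \<open>e 0\<close> is outside
    \<open>c00\<close>, where \<open>J\<close> is arbitrary.\<close>
  define coords :: "('a \<Rightarrow>\<^sub>L real) \<Rightarrow> nat \<Rightarrow> real"
    where "coords y n = (if n = 0 then 0 else blinfun_apply y (J (e n)))" for y n
  have e: "e k \<in> c00" if "k \<noteq> 0" for k using that unfolding e_def c00_def by auto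
  have zero: "(\<lambda>n. 0) \<in> c00" unfolding c00_def by simp
  have apply_J: "blinfun_apply y (J z) = pairing (coords y) z" if "z \<in> c00" for y z
  proof -
    have "blinfun_apply y (J (\<lambda>n. if n \<in> S then z n else 0)) = (\<Sum>n\<in>S. coords y n * z n)"
      if "finite S" "0 \<notin> S" for S
      using that
    proof (induction S rule: finite_induct)
      case empty
      have "J (\<lambda>n. 0) = 0" using J_scale[OF zero, of 0] by simp
      then show ?case by (simp add: blinfun.zero_right)
    next
      case (insert k S)
      let ?w = "\<lambda>n. if n \<in> S then z n else 0"
      have k: "e k \<in> c00" "(\<lambda>n. z k * e k n) \<in> c00"
        using insert.prems e by (auto simp: e_def c00_def)
      have "?w \<in> c00" using insert unfolding c00_def by auto
      moreover have "(\<lambda>n. if n \<in> insert k S then z n else 0) = (\<lambda>n. z k * e k n + ?w n)"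
        using insert.hyps by (auto simp: e_def)
      ultimately have "J (\<lambda>n. if n \<in> insert k S then z n else 0) = z k *\<^sub>R J (e k) + J ?w"
        using J_add[OF k(2)] J_scale[OF k(1)] by simp
      then show ?case
        using insert by (simp add: blinfun.add_right blinfun.scaleR_right coords_def)
    qed
    from this[of "{n. z n \<noteq> 0}"]
    have "blinfun_apply y (J (\<lambda>n. if n \<in> {n. z n \<noteq> 0} then z n else 0)) = pairing (coords y) z"
      using that unfolding pairing_def c00_def by simp
    moreover have "(\<lambda>n. if n \<in> {n. z n \<noteq> 0} then z n else 0) = z" by auto
    ultimately show ?thesis by simp
  qed
  have contr: "contractive (coords y)" if "norm y \<le> 1" for y
    unfolding contractive_def
  proof (intro conjI ballI)
    fix z assume z: "z \<in> c00"
    have "blinfun_apply y (J z) \<le> norm y * norm (J z)"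
      using norm_blinfun[of y "J z"] by (simp add: abs_le_iff)
    also have "\<dots> \<le> 1 * norm (J z)" using that by (rule mult_right_mono) simp
    finally show "pairing (coords y) z \<le> h1_norm \<A> z" using apply_J J_norm z by simp
  qed (simp add: coords_def)

  \<comment> \<open>Scaling reduces to the unit ball, negation gives the modulus, and density with
    closedness extends the bound to the whole space.\<close>
  have norm_le: "norm y \<le> r"
    if r: "0 \<le> r" and le: "\<And>z. z \<in> c00 \<Longrightarrow> h1_norm \<A> z \<le> 1 \<Longrightarrow> blinfun_apply y (J z) \<le> r"
    for y :: "'a \<Rightarrow>\<^sub>L real" and r
  proof (rule norm_blinfun_bound[OF r])
    have on_c00: "blinfun_apply y (J z) \<le> r * norm (J z)" if z: "z \<in> c00" for z
    proof (cases "J z = 0")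
      case True
      then show ?thesis by (simp add: blinfun.zero_right)
    next
      case False
      let ?w = "\<lambda>n. (1 / norm (J z)) * z n"
      have w: "?w \<in> c00" using z by (rule c00_dominated) simp
      have "h1_norm \<A> ?w = 1" using J_norm[OF w] J_scale[OF z, of "1 / norm (J z)"] False by simp
      with le[OF w] have "blinfun_apply y (J z) / norm (J z) \<le> r"
        using J_scale[OF z, of "1 / norm (J z)"] by (simp add: blinfun.scaleR_right)
      then show ?thesis using False by (simp add: divide_le_eq)
    qed
    have "norm (blinfun_apply y (J z)) \<le> r * norm (J z)" if z: "z \<in> c00" for z
    proof -
      have "(\<lambda>n. - 1 * z n) \<in> c00" using z by (rule c00_dominated) simp
      from on_c00[OF this] on_c00[OF z] show ?thesis
        unfolding J_scale[OF z] by (simp add: blinfun.minus_right abs_le_iff)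
    qed
    then have "J ` c00 \<subseteq> {x. norm (blinfun_apply y x) \<le> r * norm x}" by auto
    moreover have "closed {x. norm (blinfun_apply y x) \<le> r * norm x}"
      by (intro closed_Collect_le continuous_intros)
    ultimately have "closure (J ` c00) \<subseteq> {x. norm (blinfun_apply y x) \<le> r * norm x}"
      by (rule closure_minimal)
    then show "norm (blinfun_apply y x) \<le> r * norm x" for x using J_dense by auto
  qed

  have "\<exists>n. coords f n \<noteq> 0"
  proof (rule ccontr)
    assume "\<not> (\<exists>n. coords f n \<noteq> 0)"
    then have "norm f \<le> 0" by (intro norm_le) (simp_all add: apply_J pairing_def)
    then show False using nf by simp
  qed
  then obtain g s \<epsilon> where g: "g \<in> c00" "0 \<le> s" "s < pairing (coords f) g" and \<epsilon>: "0 < \<epsilon>"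
    and sep: "\<And>y z. contractive y \<Longrightarrow> s < pairing y g \<Longrightarrow> z \<in> c00 \<Longrightarrow> h1_norm \<A> z \<le> 1 \<Longrightarrow>
       1 - \<epsilon> < pairing (coords f) z \<Longrightarrow> \<epsilon> - 1 \<le> pairing y z"
    using separating_slice[OF assms(3) contr[of f]] nf by auto

  \<comment> \<open>Evaluation at \<open>J g\<close>, an element of the bidual. After normalisation,
    \<open>\<delta>\<close> is chosen so that the slice is cut out exactly by the threshold
    \<open>s\<close>.\<close>
  define G :: "('a \<Rightarrow>\<^sub>L real) \<Rightarrow>\<^sub>L real" where "G = Blinfun (\<lambda>y. blinfun_apply y (J g))"
  have G: "blinfun_apply G y = blinfun_apply y (J g)" for y
    unfolding G_def by (subst bounded_linear_Blinfun_apply) (auto intro: bounded_linear_intros)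
  have "s < blinfun_apply G f" using g apply_J G by simp
  also have "\<dots> \<le> norm G" using norm_blinfun[of G f] nf by (simp add: abs_le_iff)
  finally have sG: "s < norm G" .
  with g(2) have G0: "0 < norm G" by linarith
  define H where "H = (1 / norm G) *\<^sub>R G"
  have H: "norm H = 1" using G0 unfolding H_def by simp
  define \<delta> where "\<delta> = 1 - s / norm G"
  have \<delta>: "0 < \<delta>" using sG G0 unfolding \<delta>_def by simp
  have slice_iff: "y \<in> slice H \<delta> \<longleftrightarrow> norm y \<le> 1 \<and> s < pairing (coords y) g" for y
    using G0 unfolding slice_def H_def \<delta>_def
    by (simp add: scaleR_blinfun.rep_eq G apply_J[OF g(1)] divide_less_cancel)
  have "f \<in> slice H \<delta>" using slice_iff g nf by simp
  \<comment> \<open>Half of the distance gap is enough for a contradiction; the cap at 1 keeps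
    \<open>2 - min \<epsilon> 1\<close> nonnegative, as \<open>norm_le\<close> requires.\<close>
  moreover have "0 < min \<epsilon> 1 / 2" using \<epsilon> by simp
  ultimately obtain y where y: "y \<in> slice H \<delta>" and far: "2 - min \<epsilon> 1 / 2 \<le> norm (f - y)"
    using delta H \<delta> unfolding delta_point_def by blast
  have ny: "norm y \<le> 1" and sy: "s < pairing (coords y) g" using y slice_iff by auto
  have "norm (f - y) \<le> 2 - min \<epsilon> 1"
  proof (rule norm_le)
    fix z assume z: "z \<in> c00" "h1_norm \<A> z \<le> 1"
    have bnd: "\<bar>blinfun_apply h (J z)\<bar> \<le> 1" if "norm h \<le> 1" for h :: "'a \<Rightarrow>\<^sub>L real"
    proof -
      have "norm (J z) \<le> 1" using z J_norm by simp
      then have "norm h * norm (J z) \<le> 1 * 1" using that by (intro mult_mono) auto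
      then show ?thesis using norm_blinfun[of h "J z"] by simp
    qed
    \<comment> \<open>In either case one functional loses \<open>\<epsilon>\<close> at
      \<open>J z\<close>, and the other has modulus at most 1 there.\<close>
    have "blinfun_apply f (J z) \<le> 1 - \<epsilon> \<or> \<epsilon> - 1 \<le> blinfun_apply y (J z)"
      using sep[OF contr[OF ny] sy z] apply_J[OF z(1)] not_le by metis
    then show "blinfun_apply (f - y) (J z) \<le> 2 - min \<epsilon> 1"
      using bnd[of f] bnd[OF ny] nf by (auto simp: blinfun.diff_left)
  qed simp
  then show False using far \<epsilon> by simp
qed

end
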